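(* Let $r\ge 1$ and $t\ge 1$ be integers. The threshold for paths of length $t$ is $1+a_t(\mathrm{PSG}_r)$. In other words, for all sufficiently large $n$ we have $f(n,r,k)<r-1+t$ if $k=a_t(\mathrm{PSG}_r)$, and $f(n,r,k)\ge r-1+t$ if $k=1+a_t(\mathrm{PSG}_r)$.
   Context: An $r$-digraph $G$ consists of a finite vertex set $V(G)$ and an edge set $E(G)$ whose elements are ordered lists of $r$ distinct vertices. An $(r,k)$-tournament ($0\le k\le r!$) is an $r$-digraph $G$ such that for every $r$-element set $S\subseteq V(G)$, exactly $k$ of the $r!$ orderings of $S$ are edges of $G$. The tight path $P^{(r)}_s$ is the $r$-digraph with $s$ distinct vertices $v_1,\ldots,v_s$ whose edges are exactly the lists of $r$ consecutive vertices $(v_i,\ldots,v_{i+r-1})$, $1\le i\le s-r+1$ (no edges if $s<r$). An $r$-digraph $G$ contains $P^{(r)}_s$ if there is an injection of its vertices into $V(G)$ mapping edges to edges. $f(n,r,k)$ is the maximum integer $s$ such that every $n$-vertex $(r,k)$-tournament contains a copy of $P^{(r)}_s$. The threshold for paths of length $t$ is the minimum $k$ such that $f(n,r,k)\ge r-1+t$ for all sufficiently large $n$. Two lists $(a_1,\ldots,a_s)$ and $(b_1,\ldots,b_s)$, each with distinct entries, pattern-match if for all $i<j$ we have $a_i<a_j$ if and only if $b_i<b_j$. The pattern-shift graph $\mathrm{PSG}_r$ is the digraph (loops allowed) whose vertices are the permutations of $[r]=\{1,\ldots,r\}$ written as lists, with an edge from $a$ to $b$ (possibly $a=b$) if and only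 if the list of the last $r-1$ entries of $a$ and the list of the first $r-1$ entries of $b$ pattern-match. For a digraph $G$, a walk of size $t$ is a sequence $w_1\ldots w_t$ of (not necessarily distinct) vertices such that $w_iw_{i+1}$ is an edge for $1\le i<t$, and $a_t(G)$ is the maximum size of a set of vertices of $G$ inducing a subgraph with no walk of size $t$. *)

theory Defs
  imports
    Complex_Main
    "HOL-Combinatorics.Multiset_Permutations"
    "Graph_Theory.Graph_Theory"
begin

section \<open>Tournaments and tight paths\<close>

record 'a hypergraph =
  hverts :: "'a set"
  hedges :: "'a list set"

definition r_digraph :: "nat \<Rightarrow> 'a hypergraph \<Rightarrow> bool" where
  "r_digraph r G \<longleftrightarrow> finite (hverts G) \<and>
     (\<forall>e\<in>hedges G. length e = r \<and> distinct e \<and> set e \<subseteq> hverts G)"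

definition tournament :: "nat \<Rightarrow> nat \<Rightarrow> 'a hypergraph \<Rightarrow> bool" where
  "tournament r k G \<longleftrightarrow> r_digraph r G \<and> k \<le> fact r \<and>
     (\<forall>S\<subseteq>hverts G. card S = r \<longrightarrow> card (hedges G \<inter> permutations_of_set S) = k)"

definition tight_path :: "nat \<Rightarrow> nat \<Rightarrow> nat hypergraph" where
  "tight_path r s =
     \<lparr>hverts = {1..s}, hedges = {[i..<i + r] |i. 1 \<le> i \<and> i + r \<le> s + 1}\<rparr>"

definition contains_copy :: "'a hypergraph \<Rightarrow> 'b hypergraph \<Rightarrow> bool" where
  "contains_copy G H \<longleftrightarrow> (\<exists>\<phi>. inj_on \<phi> (hverts H) \<and> \<phi> ` hverts H \<subseteq> hverts G \<and>
     (\<forall>e\<in>hedges H. map \<phi> e \<in> hedges G))"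

text \<open>
  Containment is invariant under isomorphism and vertex sets are finite, so it suffices to let
  the tournaments range over those with vertices in \<^typ>\<open>nat\<close>.  For \<^prop>\<open>k \<le> fact r\<close> such tournaments
  exist on every finite vertex set, and the set below is a nonempty subset of \<open>{..n}\<close>.
\<close>

definition max_tight_path :: "nat \<Rightarrow> nat \<Rightarrow> nat \<Rightarrow> nat" where
  "max_tight_path n r k = Max {s. \<forall>G :: nat hypergraph.
     tournament r k G \<and> card (hverts G) = n \<longrightarrow> contains_copy G (tight_path r s)}"

text \<open>
  A tight path of length \<open>t\<close> (with \<open>t\<close> edges) has \<open>r - 1 + t\<close> vertices.  The minimum is over a nonempty set,
  as \<^prop>\<open>k = fact r\<close> always qualifies.
\<close>

definition path_threshold :: "nat \<Rightarrow> nat \<Rightarrow> nat" where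
  "path_threshold r t = (LEAST k. k \<le> fact r \<and>
     (\<forall>\<^sub>F n in sequentially. max_tight_path n r k \<ge> r - 1 + t))"

section \<open>The pattern-shift graph\<close>

definition pattern_match :: "nat list \<Rightarrow> nat list \<Rightarrow> bool" where
  "pattern_match a b \<longleftrightarrow> distinct a \<and> distinct b \<and> length a = length b \<and>
     (\<forall>i j. i < j \<and> j < length a \<longrightarrow> (a ! i < a ! j \<longleftrightarrow> b ! i < b ! j))"

definition PSG :: "nat \<Rightarrow> nat list pair_pre_digraph" where
  "PSG r = \<lparr>pverts = permutations_of_set {1..r},
     parcs = {(a, b). a \<in> permutations_of_set {1..r} \<and> b \<in> permutations_of_set {1..r} \<and>
       pattern_match (tl a) (butlast b)}\<rparr>"

text \<open>
  The size of a walk is its number of vertices, i.e. the length of the vertex list.  As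
  \<^const>\<open>vwalk\<close> excludes the empty list, the following is intended for \<^prop>\<open>t \<ge> 1\<close>.
\<close>

definition max_walk_free :: "nat \<Rightarrow> ('a, 'b) pre_digraph \<Rightarrow> nat" where
  "max_walk_free t G = Max {card U |U. U \<subseteq> verts G \<and> \<not> (\<exists>w. vwalk w (G \<restriction> U) \<and> length w = t)}"

end

theory Submission
  imports Defs "HOL-Library.Ramsey"
begin

text \<open>
  Order the vertices. An ordering of an \<open>r\<close>-set then has a pattern, a permutation of \<open>[r]\<close>, and the
  patterns of consecutive edges of a tight path form a walk in the pattern-shift graph. So the
  tournament whose edges are the orderings with pattern in a set \<open>U\<close> has no tight path of length \<open>t\<close>
  if \<open>U\<close> induces no walk of size \<open>t\<close>. Conversely, by Ramsey's theorem every large tournament has a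
  large vertex set all of whose \<open>r\<close>-subsets have the same set \<open>U\<close> of edge patterns. If \<open>|U|\<close> exceeds the
  maximum, then \<open>U\<close> contains a walk of size \<open>t\<close>. Realised greedily by real numbers, whose density
  leaves room for each new entry, and transported into the homogeneous set, the walk becomes a tight
  path.
\<close>

section \<open>Order-preserving enumerations\<close>

text \<open>Counting starts at 1, to match permutations of \<open>{1..r}\<close>.\<close>

definition kth_least :: "'a::linorder set \<Rightarrow> nat \<Rightarrow> 'a" where
  "kth_least S i = sorted_list_of_set S ! (i - 1)"

lemma strict_mono_on_kth_least:
  assumes "finite S"
  shows "strict_mono_on {1..card S} (kth_least S)"
proof (rule strict_mono_onI)
  fix i j assume "i \<in> {1..card S}" "j \<in> {1..card S}" "i < j"
  then show "kth_least S i < kth_least S j"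
    unfolding kth_least_def
    by (intro sorted_wrt_nth_less[OF strict_sorted_list_of_set]) auto
qed

lemma kth_least_image:
  assumes "finite S"
  shows "kth_least S ` {1..card S} = S"
proof -
  have "kth_least S ` {1..card S} = (\<lambda>i. sorted_list_of_set S ! i) ` {..<card S}"
    unfolding kth_least_def image_Suc_lessThan[symmetric] image_image by simp
  also have "\<dots> = S"
    using nth_image[of "length (sorted_list_of_set S)" "sorted_list_of_set S"] assms
    by (simp add: lessThan_atLeast0)
  finally show ?thesis .
qed

text \<open>A finite set has only one increasing enumeration. Hence a list \<open>map h p\<close>
  with increasing \<open>h\<close> is the ordering of its entries that \<open>kth_least\<close>
  assigns to the pattern \<open>p\<close>.\<close>

lemma kth_least_of_image:
  fixes h :: "nat \<Rightarrow> 'a::linorder"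
  assumes h: "strict_mono_on {1..n} h" and i: "i \<in> {1..n}"
  shows "kth_least (h ` {1..n}) i = h i"
proof -
  have "sorted_wrt (<) (map h [1..<Suc n])"
    unfolding sorted_wrt_iff_nth_less
    by (auto simp del: upt_Suc intro!: strict_mono_onD[OF h])
  moreover have "set (map h [1..<Suc n]) = h ` {1..n}"
    by (auto simp del: upt_Suc)
  ultimately have "sorted_list_of_set (h ` {1..n}) = map h [1..<Suc n]"
    using strict_sorted_equal[OF strict_sorted_list_of_set] by (metis finite_atLeastAtMost
      finite_imageI set_sorted_list_of_set)
  then show ?thesis
    using i by (auto simp: kth_least_def simp del: upt_Suc)
qed

lemma strict_mono_on_compose:
  assumes "strict_mono_on A f" "strict_mono_on B g" "f ` A \<subseteq> B"
  shows "strict_mono_on A (\<lambda>x. g (f x))"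
  using assms by (auto simp: monotone_on_def image_subset_iff)

text \<open>Send each element to the element of \<open>M\<close> of the same rank. This carries a
  realisation by reals into a homogeneous vertex set without changing any pattern.\<close>

lemma ex_strict_mono_on_into:
  fixes A :: "'a::linorder set" and M :: "'b::linorder set"
  assumes "finite A" "finite M" "card A \<le> card M"
  shows "\<exists>g. strict_mono_on A g \<and> g ` A \<subseteq> M"
proof -
  define rank where "rank x = card {y \<in> A. y \<le> x}" for x
  have "strict_mono_on A rank"
    unfolding rank_def using assms(1)
    by (intro strict_mono_onI psubset_card_mono) (auto dest: less_le_trans)
  moreover have rank: "rank ` A \<subseteq> {1..card M}"
  proof -
    have "1 \<le> rank x" if "x \<in> A" for x
      unfolding rank_def using assms(1) that by (auto simp: Suc_le_eq card_gt_0_iff)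
    moreover have "rank x \<le> card A" for x
      unfolding rank_def using assms(1) by (intro card_mono) auto
    ultimately show ?thesis using assms(3) by (force intro: order_trans)
  qed
  ultimately have "strict_mono_on A (\<lambda>x. kth_least M (rank x))"
    using strict_mono_on_compose strict_mono_on_kth_least[OF assms(2)] by blast
  moreover have "(\<lambda>x. kth_least M (rank x)) ` A \<subseteq> M"
    using rank kth_least_image[OF assms(2)] by blast
  ultimately show ?thesis by blast
qed

lemma ex_real_between_finite:
  fixes L R F :: "real set"
  assumes "finite L" "finite R" "finite F" and less: "\<And>l u. l \<in> L \<Longrightarrow> u \<in> R \<Longrightarrow> l < u"
  shows "\<exists>x. x \<notin> F \<and> (\<forall>l\<in>L. l < x) \<and> (\<forall>u\<in>R. x < u)"
proof -
  \<comment> \<open>\<open>-B\<close> and \<open>B\<close> lie beyond all given points and act as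
    endpoints when \<open>L\<close> or \<open>R\<close> is empty; inserting 0 keeps the inner
    \<open>Max\<close> meaningful when both are.\<close>
  define B where "B = Max (insert 0 (abs ` (L \<union> R))) + 1"
  have B: "- B < x \<and> x < B" if "x \<in> L \<union> R" for x
  proof -
    have "\<bar>x\<bar> \<le> Max (insert 0 (abs ` (L \<union> R)))"
      using assms that by (intro Max_ge) auto
    then show ?thesis unfolding B_def by linarith
  qed
  have "0 < B"
  proof -
    have "0 \<le> Max (insert 0 (abs ` (L \<union> R)))"
      using assms by (intro Max_ge) auto
    then show ?thesis by (simp add: B_def)
  qed
  have "Max (insert (- B) L) < Min (insert B R)"
    using assms B \<open>0 < B\<close> by auto
  then have "infinite ({Max (insert (- B) L)<..<Min (insert B R)} - F)"
    using infinite_Ioo assms(3) by (metis Diff_infinite_finite)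
  then obtain x where "x \<in> {Max (insert (- B) L)<..<Min (insert B R)} - F"
    by (metis finite.emptyI ex_in_conv)
  then show ?thesis using assms by auto
qed

section \<open>Realising walks in the pattern-shift graph\<close>

text \<open>Increasing maps preserve and reflect order, so comparisons in \<open>a\<close> and in
  \<open>b\<close> both agree with those in the common image list.\<close>

lemma pattern_match_of_map_eq:
  fixes f g :: "nat \<Rightarrow> 'a::linorder"
  assumes f: "strict_mono_on A f" and g: "strict_mono_on B g"
    and sub: "set a \<subseteq> A" "set b \<subseteq> B" and eq: "map f a = map g b" and "distinct a" "distinct b"
  shows "pattern_match a b"
proof -
  have len: "length a = length b" using eq by (rule map_eq_imp_length_eq)
  have "a ! i < a ! j \<longleftrightarrow> b ! i < b ! j" if "i < length a" "j < length a" for i j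
  proof -
    have "f (a ! i) = g (b ! i)" "f (a ! j) = g (b ! j)"
      using eq that len by (metis nth_map)+
    moreover have "a ! i \<in> A" "a ! j \<in> A" "b ! i \<in> B" "b ! j \<in> B"
      using sub that len by auto
    ultimately show ?thesis
      using strict_mono_on_less[OF f] strict_mono_on_less[OF g] by metis
  qed
  then show ?thesis using assms len by (auto simp: pattern_match_def)
qed

text \<open>The overlapping \<open>r - 1\<close> entries keep their values, and the match says that
  this assignment is increasing on all of \<open>{1..r}\<close> but the last entry of
  \<open>q\<close>. That entry gets a value in the gap left for it. \<open>F\<close> will be the set
  of values already used.\<close>

lemma extend_realisation:
  fixes h :: "nat \<Rightarrow> real"
  assumes h: "strict_mono_on {1..r} h" and "finite F" and "r \<ge> 1"
    and p: "p \<in> permutations_of_set {1..r}" and q: "q \<in> permutations_of_set {1..r}"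
    and match: "pattern_match (tl p) (butlast q)"
  shows "\<exists>h'. strict_mono_on {1..r} h' \<and> map h' (butlast q) = map h (tl p) \<and> h' (last q) \<notin> F"
proof -
  define c where "c = last q"
  have qne: "q \<noteq> []" "p \<noteq> []"
    using permutations_of_setD(1)[OF p] permutations_of_setD(1)[OF q] \<open>r \<ge> 1\<close> by auto
  have len: "length (tl p) = length (butlast q)"
    and eqv: "\<And>i j. i < j \<Longrightarrow> j < length (tl p) \<Longrightarrow> tl p ! i < tl p ! j \<longleftrightarrow> butlast q ! i < butlast q ! j"
    and dist: "distinct (tl p)" "distinct (butlast q)"
    using match by (auto simp: pattern_match_def)
  \<comment> \<open>\<open>pattern_match\<close> only compares positions \<open>i < j\<close>;
    distinctness of the entries yields the reverse comparisons.\<close>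
  have eqv': "tl p ! i < tl p ! j \<longleftrightarrow> butlast q ! i < butlast q ! j"
    if "i < length (tl p)" "j < length (tl p)" for i j
  proof (cases i j rule: linorder_cases)
    case greater
    then have "tl p ! i \<noteq> tl p ! j" "butlast q ! i \<noteq> butlast q ! j"
      using dist that len by (auto simp: nth_eq_iff_index_eq)
    then show ?thesis using eqv[OF greater] that by auto
  qed (use eqv that in auto)
  have qc: "butlast q @ [c] = q" using qne by (simp add: c_def)
  have set_q: "set (butlast q) = {1..r} - {c}" and c: "c \<in> {1..r}"
  proof -
    have "set (butlast q @ [c]) = {1..r}" "distinct (butlast q @ [c])"
      unfolding qc using permutations_of_setD[OF q] by auto
    then show "set (butlast q) = {1..r} - {c}" "c \<in> {1..r}" by auto
  qed
  have set_p: "set (tl p) \<subseteq> {1..r}"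
    using p qne by (metis list.set_sel(2) permutations_of_setD(1) subsetI)
  \<comment> \<open>The table giving each entry of \<open>butlast q\<close> the value of the entry
    of \<open>tl p\<close> in the same position. At \<open>c\<close> it is unspecified until
    \<open>h'\<close> overwrites it.\<close>
  define h0 where "h0 = the \<circ> map_of (zip (butlast q) (map h (tl p)))"
  have h0_nth: "h0 (butlast q ! i) = h (tl p ! i)" if "i < length (tl p)" for i
    using that len dist by (simp add: h0_def map_of_zip_nth)
  have h0: "h0 x < h0 y" if xy: "x \<in> {1..r} - {c}" "y \<in> {1..r} - {c}" "x < y" for x y
  proof -
    obtain i j where ij: "x = butlast q ! i" "i < length (tl p)" "y = butlast q ! j" "j < length (tl p)"
      using xy(1,2) unfolding set_q[symmetric] by (metis in_set_conv_nth len)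
    have "tl p ! i < tl p ! j" using xy(3) eqv' ij by simp
    moreover have "tl p ! i \<in> {1..r}" "tl p ! j \<in> {1..r}" using ij set_p nth_mem by blast+
    ultimately show ?thesis using strict_mono_onD[OF h] h0_nth ij by simp
  qed
  obtain x where x: "x \<notin> F" "\<forall>l\<in>h0 ` {1..<c}. l < x" "\<forall>u\<in>h0 ` {c<..r}. x < u"
    using ex_real_between_finite[of "h0 ` {1..<c}" "h0 ` {c<..r}" F] \<open>finite F\<close> c h0 by force
  define h' where "h' = h0(c := x)"
  have "strict_mono_on {1..r} h'"
  proof (rule strict_mono_onI)
    fix y z assume "y \<in> {1..r}" "z \<in> {1..r}" "y < z"
    then show "h' y < h' z"
      using x h0[of y z] by (auto simp: h'_def)
  qed
  moreover have "map h' (butlast q) = map h (tl p)"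
  proof (rule nth_equalityI)
    fix i assume "i < length (map h' (butlast q))"
    then have i: "i < length (tl p)" using len by simp
    then have "butlast q ! i \<noteq> c" using set_q len nth_mem by fastforce
    then show "map h' (butlast q) ! i = map h (tl p) ! i"
      using i len h0_nth by (simp add: h'_def)
  qed (use len in simp)
  moreover have "h' (last q) \<notin> F" using x by (simp add: h'_def c_def)
  ultimately show ?thesis by blast
qed

text \<open>Induction on \<open>t\<close>: one new real is appended per walk vertex. Earlier windows
  stay as they are, the last \<open>r - 1\<close> entries are shared with the new window, and
  avoiding \<open>set v\<close> keeps the list distinct. The increasing map \<open>h\<close> may
  change from window to window.\<close>

lemma realise_walk:
  assumes "r \<ge> 1" "t \<ge> 1"
    and "\<And>i. i < t \<Longrightarrow> w i \<in> permutations_of_set {1..r}"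
    and "\<And>i. Suc i < t \<Longrightarrow> pattern_match (tl (w i)) (butlast (w (Suc i)))"
  shows "\<exists>v :: real list. distinct v \<and> length v = r - 1 + t \<and>
    (\<forall>i<t. \<exists>h. strict_mono_on {1..r} h \<and> map h (w i) = take r (drop i v))"
  using assms(2-)
proof (induction t rule: dec_induct)
  case base
  then have w: "set (w 0) = {1..r}" "distinct (w 0)" "length (w 0) = r"
    using length_finite_permutations_of_set[of "w 0" "{1..r}"]
    by (auto dest: permutations_of_setD)
  have "distinct (map real (w 0))" using w by (simp add: distinct_map)
  moreover have "strict_mono_on {1..r} real" by (simp add: monotone_on_def)
  ultimately show ?case
    using w \<open>r \<ge> 1\<close> by (intro exI[of _ "map real (w 0)"]) auto
next
  case (step t)
  then obtain v :: "real list" where v: "distinct v" "length v = r - 1 + t"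
    and win: "\<And>i. i < t \<Longrightarrow> \<exists>h. strict_mono_on {1..r} h \<and> map h (w i) = take r (drop i v)"
    by (metis less_SucI)
  obtain s where s: "t = Suc s" using \<open>1 \<le> t\<close> by (cases t) auto
  obtain h where h: "strict_mono_on {1..r} h" "map h (w s) = take r (drop s v)"
    using win[of s] s by auto
  have mem: "w s \<in> permutations_of_set {1..r}" "w t \<in> permutations_of_set {1..r}"
    using step.prems(1) s by auto
  have "pattern_match (tl (w s)) (butlast (w t))" using step.prems(2) s by auto
  then obtain h' where h': "strict_mono_on {1..r} h'" "map h' (butlast (w t)) = map h (tl (w s))"
      "h' (last (w t)) \<notin> set v"
    using extend_realisation[OF h(1) _ \<open>r \<ge> 1\<close> mem] by blast
  define v' where "v' = v @ [h' (last (w t))]"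
  have ne: "w t \<noteq> []" using permutations_of_setD(1)[OF mem(2)] \<open>r \<ge> 1\<close> by auto
  have "map h' (w t) = map h' (butlast (w t)) @ [h' (last (w t))]"
    using ne by (metis append_butlast_last_id list.simps(8,9) map_append)
  also have "map h' (butlast (w t)) = tl (map h (w s))"
    using h'(2) by (simp add: map_tl)
  \<comment> \<open>Since \<open>v\<close> has length \<open>r - 1 + t\<close>, the window at
    \<open>s\<close> without its head is exactly the last \<open>r - 1\<close> entries of
    \<open>v\<close>.\<close>
  also have "\<dots> = drop t v"
    using h(2) v(2) s \<open>r \<ge> 1\<close> by (simp add: drop_Suc tl_drop)
  finally have last: "map h' (w t) = take r (drop t v')"
    using v(2) \<open>r \<ge> 1\<close> by (simp add: v'_def)
  have "\<exists>h. strict_mono_on {1..r} h \<and> map h (w i) = take r (drop i v')" if "i < Suc t" for i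
  proof (cases "i < t")
    case True
    then have "take r (drop i v') = take r (drop i v)"
      using v(2) \<open>r \<ge> 1\<close> by (simp add: v'_def)
    then show ?thesis using win[OF True] by simp
  next
    case False
    then have "i = t" using that by simp
    then show ?thesis using h'(1) last by blast
  qed
  moreover have "distinct v'" "length v' = r - 1 + Suc t"
    using v h'(3) by (auto simp: v'_def)
  ultimately show ?case by blast
qed

section \<open>Walks of induced subgraphs, position by position\<close>

lemma set_vwalk_arcs_nth:
  "set (vwalk_arcs w) = {(w ! i, w ! Suc i) |i. Suc i < length w}"
proof (induction w rule: vwalk_arcs.induct)
  case (3 x y xs)
  have "{((x # y # xs) ! i, (x # y # xs) ! Suc i) |i. Suc i < length (x # y # xs)} =
    insert (x, y) {((y # xs) ! i, (y # xs) ! Suc i) |i. Suc i < length (y # xs)}"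
    (is "?L = ?R")
  proof (intro set_eqI iffI)
    fix e assume "e \<in> ?L"
    then obtain i where "Suc i < length (x # y # xs)" "e = ((x # y # xs) ! i, (x # y # xs) ! Suc i)"
      by blast
    then show "e \<in> ?R" by (cases i) auto
  next
    fix e assume "e \<in> ?R"
    then consider "e = (x, y)" | i where "Suc i < length (y # xs)" "e = ((y # xs) ! i, (y # xs) ! Suc i)"
      by blast
    then show "e \<in> ?L"
    proof cases
      case 1
      then show ?thesis by (intro CollectI exI[of _ 0]) auto
    next
      case 2
      then show ?thesis by (intro CollectI exI[of _ "Suc i"]) auto
    qed
  qed
  then show ?case using 3 by simp
qed auto

lemma vwalk_PSG_iff:
  assumes "U \<subseteq> permutations_of_set {1..r}"
  shows "vwalk w (with_proj (PSG r) \<restriction> U) \<longleftrightarrow> w \<noteq> [] \<and> set w \<subseteq> U \<and>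
    (\<forall>i. Suc i < length w \<longrightarrow> pattern_match (tl (w ! i)) (butlast (w ! Suc i)))"
proof -
  have "arcs_ends (with_proj (PSG r) \<restriction> U) = {(a, b). a \<in> U \<and> b \<in> U \<and> pattern_match (tl a) (butlast b)}"
    using assms by (auto simp: arcs_ends_def arc_to_ends_def PSG_def induce_subgraph_def)
  then show ?thesis
    by (fastforce simp: vwalk_def set_vwalk_arcs_nth subset_iff)
qed

section \<open>Tournaments given by patterns\<close>

definition pattern_tournament :: "nat \<Rightarrow> nat list set \<Rightarrow> nat set \<Rightarrow> nat hypergraph" where
  "pattern_tournament r U V = \<lparr>hverts = V,
     hedges = {map (kth_least S) p |S p. S \<subseteq> V \<and> card S = r \<and> p \<in> U}\<rparr>"

lemma permutations_of_set_kth_least: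
  assumes "finite S"
  shows "permutations_of_set S = map (kth_least S) ` permutations_of_set {1..card S}"
  using permutations_of_set_image_inj[OF strict_mono_on_imp_inj_on[OF strict_mono_on_kth_least[OF assms]]]
  unfolding kth_least_image[OF assms] .

lemma inj_on_map_kth_least:
  assumes "finite S"
  shows "inj_on (map (kth_least S)) (permutations_of_set {1..card S})"
proof (rule inj_onI)
  fix p q
  assume p: "p \<in> permutations_of_set {1..card S}" and q: "q \<in> permutations_of_set {1..card S}"
    and eq: "map (kth_least S) p = map (kth_least S) q"
  have "inj_on (kth_least S) (set p \<union> set q)"
    using strict_mono_on_imp_inj_on[OF strict_mono_on_kth_least[OF assms]] p q
    by (simp add: permutations_of_setD)
  then show "p = q" using eq by (simp add: inj_on_map_eq_map)
qed

lemma tournament_pattern_tournament: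
  assumes U: "U \<subseteq> permutations_of_set {1..r}" and V: "finite V"
  shows "tournament r (card U) (pattern_tournament r U V)"
proof -
  have mem: "map (kth_least S) p \<in> permutations_of_set S" if "S \<subseteq> V" "card S = r" "p \<in> U" for S p
    using that U V by (subst permutations_of_set_kth_least) (auto intro: finite_subset)
  have "length e = r \<and> distinct e \<and> set e \<subseteq> V" if "e \<in> hedges (pattern_tournament r U V)" for e
  proof -
    obtain S where S: "S \<subseteq> V" "card S = r" "e \<in> permutations_of_set S"
    proof -
      obtain S p where "S \<subseteq> V" "card S = r" "p \<in> U" "e = map (kth_least S) p"
        using \<open>e \<in> _\<close> by (auto simp: pattern_tournament_def)
      then show ?thesis using mem that by blast
    qed
    then show ?thesis
      using length_finite_permutations_of_set[OF S(3)] by (auto dest: permutations_of_setD)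
  qed
  then have "r_digraph r (pattern_tournament r U V)"
    using V by (auto simp: r_digraph_def pattern_tournament_def)
  moreover have "card U \<le> fact r"
    using card_mono[OF _ U] by simp
  moreover have "card (hedges (pattern_tournament r U V) \<inter> permutations_of_set S) = card U"
    if S: "S \<subseteq> V" "card S = r" for S
  proof -
    have fin: "finite S" using S V finite_subset by blast
    have "hedges (pattern_tournament r U V) \<inter> permutations_of_set S = map (kth_least S) ` U"
      (is "?L = ?R")
    proof
      show "?L \<subseteq> ?R"
      proof
        fix e assume e: "e \<in> ?L"
        then obtain S' p where S': "S' \<subseteq> V" "card S' = r" "p \<in> U" "e = map (kth_least S') p"
          by (auto simp: pattern_tournament_def)
        then have "e \<in> permutations_of_set S'" "e \<in> permutations_of_set S" using mem e by auto
        \<comment> \<open>The entries of an edge determine its \<open>r\<close>-set, so an edge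
          ordering \<open>S\<close> was produced from \<open>S\<close> itself and not from another
          set.\<close>
        then have "set e = S'" "set e = S" by (auto dest: permutations_of_setD(1))
        then show "e \<in> ?R" using S' by blast
      qed
      show "?R \<subseteq> ?L"
        using mem S by (auto simp: pattern_tournament_def)
    qed
    moreover have "inj_on (map (kth_least S)) U"
      using inj_on_map_kth_least[OF fin] S(2) U by (auto intro: inj_on_subset)
    ultimately show ?thesis by (simp add: card_image)
  qed
  ultimately show ?thesis
    by (auto simp: tournament_def pattern_tournament_def)
qed

section \<open>From tight paths to walks\<close>

lemma contains_copy_tight_path_card:
  assumes "contains_copy G (tight_path r s)" "finite (hverts G)"
  shows "s \<le> card (hverts G)"
proof -
  obtain \<phi> where "inj_on \<phi> {1..s}" "\<phi> ` {1..s} \<subseteq> hverts G"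
    using assms(1) by (auto simp: contains_copy_def tight_path_def)
  then have "card {1..s} \<le> card (hverts G)" using assms(2) card_inj_on_le by blast
  then show ?thesis by simp
qed

text \<open>Each of the first \<open>t\<close> edges of the path has a pattern in \<open>U\<close>.
  Consecutive edges share \<open>r - 1\<close> vertices, so consecutive patterns match
  there.\<close>

lemma walk_of_tight_path:
  assumes U: "U \<subseteq> permutations_of_set {1..r}" and V: "finite V" and r: "r \<ge> 1" and t: "t \<ge> 1"
    and s: "r - 1 + t \<le> s" and copy: "contains_copy (pattern_tournament r U V) (tight_path r s)"
  shows "\<exists>w. vwalk w (with_proj (PSG r) \<restriction> U) \<and> length w = t"
proof -
  obtain \<phi> where \<phi>: "\<And>i. 1 \<le> i \<Longrightarrow> i + r \<le> s + 1 \<Longrightarrow> map \<phi> [i..<i + r] \<in> hedges (pattern_tournament r U V)"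
    using copy by (auto simp: contains_copy_def tight_path_def) blast
  \<comment> \<open>The path starts at vertex 1 and the walk at index 0, hence
    \<open>Suc i\<close>.\<close>
  have "\<exists>S p. map \<phi> [Suc i..<Suc i + r] = map (kth_least S) p \<and> S \<subseteq> V \<and> card S = r \<and> p \<in> U"
    if "i < t" for i
    using \<phi>[of "Suc i"] that s r by (auto simp: pattern_tournament_def)
  then obtain S p where Sp: "\<And>i. i < t \<Longrightarrow> map \<phi> [Suc i..<Suc i + r] = map (kth_least (S i)) (p i)
      \<and> S i \<subseteq> V \<and> card (S i) = r \<and> p i \<in> U"
    by metis
  have mono: "strict_mono_on {1..r} (kth_least (S i))" if "i < t" for i
    using strict_mono_on_kth_least[of "S i"] Sp[OF that] V by (metis finite_subset)
  have "pattern_match (tl (p i)) (butlast (p (Suc i)))" if i: "Suc i < t" for i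
  proof (rule pattern_match_of_map_eq)
    have it: "i < t" using i by simp
    have p: "p i \<in> permutations_of_set {1..r}" "p (Suc i) \<in> permutations_of_set {1..r}"
      using Sp[OF it] Sp[OF i] U by auto
    then have ps: "set (p i) = {1..r}" "set (p (Suc i)) = {1..r}"
      "distinct (p i)" "distinct (p (Suc i))" by (auto dest: permutations_of_setD)
    show "strict_mono_on {1..r} (kth_least (S i))" "strict_mono_on {1..r} (kth_least (S (Suc i)))"
      using mono it i by auto
    show "set (tl (p i)) \<subseteq> {1..r}"
      using ps(1) by (metis list.set_sel(2) subsetI tl_Nil)
    show "set (butlast (p (Suc i))) \<subseteq> {1..r}"
      using ps(2) by (metis in_set_butlastD subsetI)
    show "distinct (tl (p i))" "distinct (butlast (p (Suc i)))"
      using ps by (auto simp: distinct_tl distinct_butlast)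
    have "map (kth_least (S i)) (tl (p i)) = map \<phi> (tl [Suc i..<Suc i + r])"
      using Sp[OF it] by (simp add: map_tl)
    \<comment> \<open>The overlap: an edge without its first vertex is the next edge without its
      last one.\<close>
    also have "tl [Suc i..<Suc i + r] = butlast [Suc (Suc i)..<Suc (Suc i) + r]"
      using r by (cases r) (auto simp: upt_conv_Cons)
    also have "map \<phi> \<dots> = map (kth_least (S (Suc i))) (butlast (p (Suc i)))"
      using Sp[OF i] by (simp add: map_butlast)
    finally show "map (kth_least (S i)) (tl (p i)) = map (kth_least (S (Suc i))) (butlast (p (Suc i)))" .
  qed
  then have "vwalk (map p [0..<t]) (with_proj (PSG r) \<restriction> U)"
    using Sp t by (auto simp: vwalk_PSG_iff[OF U])
  then show ?thesis by (intro exI[of _ "map p [0..<t]"]) simp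
qed

section \<open>Homogeneous vertex sets\<close>

text \<open>The colour of an \<open>r\<close>-set in the Ramsey argument. Writing edges as patterns
  makes the colours of different sets comparable.\<close>

definition edge_patterns :: "nat \<Rightarrow> nat hypergraph \<Rightarrow> nat set \<Rightarrow> nat list set" where
  "edge_patterns r G S = {p \<in> permutations_of_set {1..r}. map (kth_least S) p \<in> hedges G}"

text \<open>Patterns correspond bijectively to orderings of \<open>S\<close>, so every colour that
  occurs on an \<open>r\<close>-set has exactly \<open>k\<close> elements.\<close>

lemma card_edge_patterns:
  assumes G: "tournament r k G" and S: "S \<subseteq> hverts G" "card S = r"
  shows "card (edge_patterns r G S) = k"
proof -
  have "finite S"
    using G S by (auto simp: tournament_def r_digraph_def intro: finite_subset)
  then have "map (kth_least S) ` edge_patterns r G S = hedges G \<inter> permutations_of_set S"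
    using permutations_of_set_kth_least[of S] S(2) by (auto simp: edge_patterns_def)
  moreover have "inj_on (map (kth_least S)) (edge_patterns r G S)"
    using inj_on_map_kth_least[OF \<open>finite S\<close>] S(2)
    by (auto simp: edge_patterns_def intro: inj_on_subset)
  ultimately have "card (edge_patterns r G S) = card (hedges G \<inter> permutations_of_set S)"
    by (metis card_image)
  also have "\<dots> = k" using G S by (simp add: tournament_def)
  finally show ?thesis .
qed

text \<open>Ramsey's theorem for \<open>r\<close>-sets, coloured by their edge patterns. The colours
  are sets of permutations of \<open>{1..r}\<close>, so \<open>N\<close> depends on \<open>m\<close>
  and \<open>r\<close> only.\<close>

lemma ex_homogeneous_set:
  "\<exists>N. \<forall>G. finite (hverts G) \<and> card (hverts G) \<ge> N \<longrightarrow>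
     (\<exists>M U. M \<subseteq> hverts G \<and> card M = m \<and> (\<forall>S\<subseteq>M. card S = r \<longrightarrow> edge_patterns r G S = U))"
proof -
  define C where "C = Pow (permutations_of_set {1..r})"
  have "finite C" by (simp add: C_def)
  then obtain c :: "nat list set \<Rightarrow> nat" where c: "bij_betw c C {0..<card C}"
    using ex_bij_betw_finite_nat by blast
  obtain N :: nat where N: "partn_lst {..<N} (replicate (card C) m) r"
    using ramsey_full by blast
  have "\<exists>M U. M \<subseteq> hverts G \<and> card M = m \<and> (\<forall>S\<subseteq>M. card S = r \<longrightarrow> edge_patterns r G S = U)"
    if fin: "finite (hverts G)" and n: "card (hverts G) \<ge> N" for G
  proof -
    \<comment> \<open>\<open>partn_lst\<close> is applied to initial segments of the naturals, so
      the vertices are numbered from 0; \<open>Suc\<close> compensates for \<open>kth_least\<close>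
      counting from 1.\<close>
    define e where "e j = kth_least (hverts G) (Suc j)" for j
    have e_img: "e ` {..<card (hverts G)} = hverts G"
      using kth_least_image[OF fin] unfolding e_def image_Suc_lessThan[symmetric] image_image .
    then have e_inj: "inj_on e {..<card (hverts G)}"
      by (intro eq_card_imp_inj_on) auto
    define f where "f X = c (edge_patterns r G (e ` X))" for X
    have patC: "edge_patterns r G S \<in> C" for S
      by (auto simp: C_def edge_patterns_def)
    then have "f \<in> nsets {..<card (hverts G)} r \<rightarrow> {..<card C}"
      using bij_betwE[OF c] by (auto simp: f_def)
    then obtain i H where i: "i < card C" and H: "H \<in> nsets {..<card (hverts G)} m"
      and mono: "f ` nsets H r \<subseteq> {i}"
      using partn_lstE[OF partn_lst_greater_resource[OF N n]]
      by (metis length_replicate nth_replicate)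
    have Hsub: "H \<subseteq> {..<card (hverts G)}" "card H = m" "finite H"
      using H by (auto simp: nsets_def)
    have inj: "inj_on e H" using e_inj Hsub(1) inj_on_subset by blast
    \<comment> \<open>The common \<open>U\<close> is the colour with number
      \<open>i\<close>.\<close>
    have "edge_patterns r G S = the_inv_into C c i" if "S \<subseteq> e ` H" "card S = r" for S
    proof -
      obtain X where X: "X \<subseteq> H" "S = e ` X" using \<open>S \<subseteq> e ` H\<close> by (meson subset_imageE)
      have "card X = r"
        using X \<open>card S = r\<close> inj by (metis card_image inj_on_subset)
      then have "X \<in> nsets H r"
        using X Hsub(3) by (auto simp: nsets_def intro: finite_subset)
      then have "c (edge_patterns r G S) = i" using mono X(2) by (auto simp: f_def)
      then show ?thesis using the_inv_into_f_f[OF bij_betw_imp_inj_on[OF c] patC] by metis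
    qed
    moreover have "e ` H \<subseteq> hverts G" using Hsub(1) e_img by blast
    moreover have "card (e ` H) = m" using inj Hsub(2) by (simp add: card_image)
    ultimately show ?thesis by blast
  qed
  then show ?thesis by blast
qed

text \<open>Realise the walk by reals and move it into \<open>M\<close> by an increasing map. Each
  window is then an ordering of an \<open>r\<close>-subset of \<open>M\<close> with a pattern in
  \<open>U\<close>, and by homogeneity all such orderings are edges.\<close>

lemma tight_path_in_homogeneous_set:
  assumes r: "r \<ge> 1" and t: "t \<ge> 1"
    and M: "M \<subseteq> hverts G" "finite M" "card M = r - 1 + t"
    and hom: "\<And>S. S \<subseteq> M \<Longrightarrow> card S = r \<Longrightarrow> edge_patterns r G S = U"
    and U: "U \<subseteq> permutations_of_set {1..r}"
    and w: "vwalk w (with_proj (PSG r) \<restriction> U)" "length w = t"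
  shows "contains_copy G (tight_path r (r - 1 + t))"
proof -
  have wU: "w ! i \<in> U" if "i < t" for i
    using w that by (auto simp: vwalk_PSG_iff[OF U])
  obtain v :: "real list" where v: "distinct v" "length v = r - 1 + t"
    and win: "\<And>i. i < t \<Longrightarrow> \<exists>h. strict_mono_on {1..r} h \<and> map h (w ! i) = take r (drop i v)"
    using realise_walk[OF r t, of "\<lambda>i. w ! i"] wU U w by (auto simp: vwalk_PSG_iff[OF U])
  have "card (set v) \<le> card M" using v M by (simp add: distinct_card)
  then obtain g where g: "strict_mono_on (set v) g" "g ` set v \<subseteq> M"
    using ex_strict_mono_on_into[OF finite_set M(2)] by metis
  define \<phi> where "\<phi> i = g (v ! (i - 1))" for i
  have "inj_on (\<lambda>i. v ! (i - 1)) {1..r - 1 + t}"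
    using v by (auto simp: inj_on_def nth_eq_iff_index_eq)
  moreover have img: "(\<lambda>i. v ! (i - 1)) ` {1..r - 1 + t} \<subseteq> set v"
    using v(2) by (auto intro!: nth_mem)
  ultimately have "inj_on \<phi> {1..r - 1 + t}"
    using strict_mono_on_imp_inj_on[OF g(1)] unfolding \<phi>_def inj_on_def image_subset_iff by blast
  moreover have "\<phi> ` {1..r - 1 + t} \<subseteq> hverts G"
    using img g(2) M(1) by (auto simp: \<phi>_def)
  moreover have "map \<phi> [i..<i + r] \<in> hedges G" if i: "1 \<le> i" "i + r \<le> r - 1 + t + 1" for i
  proof -
    have i': "i - 1 < t" using i r by simp
    obtain h where h: "strict_mono_on {1..r} h" "map h (w ! (i - 1)) = take r (drop (i - 1) v)"
      using win[OF i'] by blast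
    have p: "w ! (i - 1) \<in> permutations_of_set {1..r}" using wU[OF i'] U by blast
    then have set_p: "set (w ! (i - 1)) = {1..r}" by (rule permutations_of_setD)
    have "set (map h (w ! (i - 1))) \<subseteq> set v"
      unfolding h(2) by (meson set_drop_subset set_take_subset subset_trans)
    then have hv: "h ` {1..r} \<subseteq> set v" using set_p by simp
    define S where "S = (\<lambda>x. g (h x)) ` {1..r}"
    have gh: "strict_mono_on {1..r} (\<lambda>x. g (h x))"
      using strict_mono_on_compose[OF h(1) g(1) hv] .
    have "S \<subseteq> M" using hv g(2) by (auto simp: S_def)
    moreover have "card S = r"
      using card_image[OF strict_mono_on_imp_inj_on[OF gh]] by (simp add: S_def)
    ultimately have "edge_patterns r G S = U" by (rule hom)
    then have "map (kth_least S) (w ! (i - 1)) \<in> hedges G"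
      using wU[OF i'] by (auto simp: edge_patterns_def)
    \<comment> \<open>On \<open>{1..r}\<close> the increasing map \<open>g\<close> after
      \<open>h\<close> is the enumeration of its image \<open>S\<close>.\<close>
    also have "map (kth_least S) (w ! (i - 1)) = map g (map h (w ! (i - 1)))"
      using kth_least_of_image[OF gh] set_p by (auto simp: S_def)
    also have "\<dots> = map g (take r (drop (i - 1) v))"
      by (simp only: h(2))
    also have "\<dots> = map \<phi> [i..<i + r]"
    proof (rule nth_equalityI)
      show "length (map g (take r (drop (i - 1) v))) = length (map \<phi> [i..<i + r])"
        using i v(2) by simp
      fix j assume "j < length (map g (take r (drop (i - 1) v)))"
      then have "j < r" "i - 1 + j < length v" by auto
      moreover have "i + j - 1 = i - 1 + j" using i(1) by simp
      ultimately show "map g (take r (drop (i - 1) v)) ! j = map \<phi> [i..<i + r] ! j"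
        by (simp add: \<phi>_def)
    qed
    finally show ?thesis .
  qed
  ultimately show ?thesis
    unfolding contains_copy_def tight_path_def by (intro exI[of _ \<phi>]) auto
qed

section \<open>The threshold\<close>

text \<open>Attainment supplies the patterns of a tournament with no long path; maximality forces a
  walk in the patterns of a homogeneous set.\<close>

lemma max_walk_free_PSG:
  fixes r t :: nat
  assumes "t \<ge> 1"
  defines "A \<equiv> max_walk_free t (with_proj (PSG r))"
  shows "\<exists>U\<subseteq>permutations_of_set {1..r}. card U = A \<and>
      \<not> (\<exists>w. vwalk w (with_proj (PSG r) \<restriction> U) \<and> length w = t)"
    and "\<And>U. U \<subseteq> permutations_of_set {1..r} \<Longrightarrow> A < card U \<Longrightarrow>
      \<exists>w. vwalk w (with_proj (PSG r) \<restriction> U) \<and> length w = t"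
proof -
  define X where "X = {card U |U. U \<subseteq> verts (with_proj (PSG r)) \<and>
    \<not> (\<exists>w. vwalk w (with_proj (PSG r) \<restriction> U) \<and> length w = t)}"
  have verts: "verts (with_proj (PSG r)) = permutations_of_set {1..r}" by (simp add: PSG_def)
  have "X \<subseteq> card ` Pow (permutations_of_set {1..r})" unfolding X_def verts by blast
  then have fin: "finite X" by (rule finite_subset) simp
  \<comment> \<open>The empty set qualifies because \<open>vwalk\<close> excludes the empty list, so
    \<open>Max\<close> is taken over a nonempty set.\<close>
  have "card ({} :: nat list set) \<in> X"
    unfolding X_def verts by (rule CollectI, rule exI[of _ "{}"]) (auto simp: vwalk_PSG_iff)
  then have "Max X \<in> X" using fin Max_in by blast
  moreover have A: "A = Max X" by (simp add: A_def max_walk_free_def X_def)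
  ultimately have "A \<in> X" by simp
  then show "\<exists>U\<subseteq>permutations_of_set {1..r}. card U = A \<and>
      \<not> (\<exists>w. vwalk w (with_proj (PSG r) \<restriction> U) \<and> length w = t)"
    unfolding X_def verts by blast
  show "\<exists>w. vwalk w (with_proj (PSG r) \<restriction> U) \<and> length w = t"
    if "U \<subseteq> permutations_of_set {1..r}" "A < card U" for U
  proof (rule ccontr)
    assume "\<not> ?thesis"
    then have "card U \<in> X" unfolding X_def verts using that(1) by blast
    then show False using Max_ge[OF fin] that(2) A by fastforce
  qed
qed

text \<open>A walk-free set misses at least one permutation. This makes one more than the maximum an
  admissible \<open>k\<close>.\<close>

lemma max_walk_free_PSG_less_fact:
  assumes "t \<ge> 1" "r \<ge> 1"
  shows "max_walk_free t (with_proj (PSG r)) < fact r"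
proof -
  obtain U where U: "U \<subseteq> permutations_of_set {1..r}"
      "card U = max_walk_free t (with_proj (PSG r))"
      "\<not> (\<exists>w. vwalk w (with_proj (PSG r) \<restriction> U) \<and> length w = t)"
    using max_walk_free_PSG(1)[OF assms(1)] by blast
  define a where "a = [1..<Suc r]"
  \<comment> \<open>The increasing permutation carries a loop.\<close>
  have "pattern_match (tl a) (butlast a)"
    by (auto simp: pattern_match_def a_def nth_tl nth_butlast distinct_tl distinct_butlast simp del: upt_Suc)
  then have "vwalk (replicate t a) (with_proj (PSG r) \<restriction> U)" if "a \<in> U"
    using that assms(1) by (auto simp: vwalk_PSG_iff[OF U(1)])
  then have "a \<notin> U" using U(3) by force
  moreover have "a \<in> permutations_of_set {1..r}"
    unfolding a_def by (rule permutations_of_setI) (auto simp del: upt_Suc)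
  ultimately have "U \<subset> permutations_of_set {1..r}" using U(1) by blast
  then have "card U < card (permutations_of_set {1..r})"
    by (intro psubset_card_mono) auto
  then show ?thesis using U(2) by simp
qed

text \<open>For \<open>k\<close> at most \<open>fact r\<close> some tournament on \<open>n\<close>
  vertices exists, and it contains no path with more than \<open>n\<close> vertices. This makes the
  \<open>Max\<close> in \<open>max_tight_path\<close> meaningful.\<close>

lemma finite_common_path_sizes:
  assumes "k \<le> fact r"
  shows "finite {s. \<forall>G :: nat hypergraph.
    tournament r k G \<and> card (hverts G) = n \<longrightarrow> contains_copy G (tight_path r s)}"
    (is "finite ?X")
proof -
  obtain U where U: "U \<subseteq> permutations_of_set {1..r}" "card U = k"
    using assms by (metis card_atLeastAtMost card_permutations_of_set diff_Suc_1
      finite_atLeastAtMost obtain_subset_with_card_n)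
  have "?X \<subseteq> {..n}"
  proof
    fix s assume "s \<in> ?X"
    then have "contains_copy (pattern_tournament r U {..<n}) (tight_path r s)"
      using tournament_pattern_tournament[OF U(1), of "{..<n}"] U(2)
      by (auto simp: pattern_tournament_def)
    then show "s \<in> {..n}"
      using contains_copy_tight_path_card by (fastforce simp: pattern_tournament_def)
  qed
  then show ?thesis by (rule finite_subset) simp
qed

lemma max_tight_path_ge:
  assumes "k \<le> fact r" and "\<And>G :: nat hypergraph. tournament r k G \<Longrightarrow> card (hverts G) = n \<Longrightarrow>
    contains_copy G (tight_path r s)"
  shows "s \<le> max_tight_path n r k"
  unfolding max_tight_path_def
  by (rule Max_ge[OF finite_common_path_sizes[OF assms(1)]]) (use assms(2) in blast)

text \<open>A subset of a walk-free set is walk-free, so all smaller \<open>k\<close> are covered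
  too, as minimality of the threshold requires. The bound holds for every \<open>n\<close>.\<close>

lemma max_tight_path_less:
  assumes r: "r \<ge> 1" and t: "t \<ge> 1" and k: "k \<le> max_walk_free t (with_proj (PSG r))"
  shows "max_tight_path n r k < r - 1 + t"
proof -
  obtain U0 where U0: "U0 \<subseteq> permutations_of_set {1..r}"
      "card U0 = max_walk_free t (with_proj (PSG r))"
      "\<not> (\<exists>w. vwalk w (with_proj (PSG r) \<restriction> U0) \<and> length w = t)"
    using max_walk_free_PSG(1)[OF t] by blast
  have "k \<le> card U0" using k U0(2) by simp
  then obtain U where U: "U \<subseteq> U0" "card U = k"
    using obtain_subset_with_card_n by metis
  have Usub: "U \<subseteq> permutations_of_set {1..r}" using U(1) U0(1) by blast
  have no: "\<not> (\<exists>w. vwalk w (with_proj (PSG r) \<restriction> U) \<and> length w = t)"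
    using U0(3) U(1) by (auto simp: vwalk_PSG_iff[OF Usub] vwalk_PSG_iff[OF U0(1)])
  define X where "X = {s. \<forall>G :: nat hypergraph.
     tournament r k G \<and> card (hverts G) = n \<longrightarrow> contains_copy G (tight_path r s)}"
  have "k \<le> fact r"
    using k max_walk_free_PSG_less_fact[OF t r] by simp
  then have fin: "finite X" using finite_common_path_sizes by (simp add: X_def)
  \<comment> \<open>With \<open>r\<close> positive the path on 0 vertices has no edges, so the set
    under \<open>Max\<close> is nonempty.\<close>
  have "0 \<in> X" using r by (auto simp: X_def contains_copy_def tight_path_def)
  moreover have "s < r - 1 + t" if "s \<in> X" for s
  proof (rule ccontr)
    assume "\<not> s < r - 1 + t"
    moreover have "contains_copy (pattern_tournament r U {..<n}) (tight_path r s)"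
      using that tournament_pattern_tournament[OF Usub, of "{..<n}"] U(2)
      by (auto simp: X_def pattern_tournament_def)
    ultimately show False
      using walk_of_tight_path[OF Usub finite_lessThan r t _] no by (metis not_less)
  qed
  ultimately have "Max X < r - 1 + t" using fin by (subst Max_less_iff) auto
  then show ?thesis by (simp add: max_tight_path_def X_def)
qed

lemma eventually_max_tight_path_ge:
  assumes r: "r \<ge> 1" and t: "t \<ge> 1"
    and k: "max_walk_free t (with_proj (PSG r)) < k" "k \<le> fact r"
  shows "\<forall>\<^sub>F n in sequentially. max_tight_path n r k \<ge> r - 1 + t"
proof -
  obtain N where N: "\<And>G. finite (hverts G) \<Longrightarrow> card (hverts G) \<ge> N \<Longrightarrow>
     \<exists>M U. M \<subseteq> hverts G \<and> card M = r - 1 + t \<and> (\<forall>S\<subseteq>M. card S = r \<longrightarrow> edge_patterns r G S = U)"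
    using ex_homogeneous_set by metis
  have "contains_copy G (tight_path r (r - 1 + t))"
    if G: "tournament r k G" "card (hverts G) = n" and n: "n \<ge> N" for n and G :: "nat hypergraph"
  proof -
    have fin: "finite (hverts G)" using G by (auto simp: tournament_def r_digraph_def)
    then obtain M U where M: "M \<subseteq> hverts G" "card M = r - 1 + t"
      and hom: "\<And>S. S \<subseteq> M \<Longrightarrow> card S = r \<Longrightarrow> edge_patterns r G S = U"
      using N[of G] G(2) n by blast
    \<comment> \<open>As \<open>t\<close> is positive, \<open>M\<close> has an
      \<open>r\<close>-subset. Hence \<open>U\<close> is the pattern set of an actual
      \<open>r\<close>-set and has \<open>k\<close> elements.\<close>
    have "r \<le> card M" using M(2) t by simp
    then obtain S where S: "S \<subseteq> M" "card S = r" using obtain_subset_with_card_n by metis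
    then have U: "U = edge_patterns r G S" using hom by simp
    then have "card U = k" using card_edge_patterns[OF G(1)] S M(1) by blast
    moreover have Usub: "U \<subseteq> permutations_of_set {1..r}" by (auto simp: U edge_patterns_def)
    ultimately obtain w where "vwalk w (with_proj (PSG r) \<restriction> U)" "length w = t"
      using max_walk_free_PSG(2)[OF t] k(1) by blast
    moreover have "finite M" using fin M(1) finite_subset by blast
    ultimately show ?thesis
      using tight_path_in_homogeneous_set[OF r t M(1) _ M(2) hom Usub] by blast
  qed
  then have "max_tight_path n r k \<ge> r - 1 + t" if "n \<ge> N" for n
    using max_tight_path_ge[OF k(2)] that by blast
  then show ?thesis by (auto simp: eventually_sequentially)
qed

theorem theorem2:
  fixes r t :: nat
  assumes "r \<ge> 1" and "t \<ge> 1"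
  shows "path_threshold r t = 1 + max_walk_free t (with_proj (PSG r)) \<and>
    (\<forall>\<^sub>F n in sequentially.
       max_tight_path n r (max_walk_free t (with_proj (PSG r))) < r - 1 + t) \<and>
    (\<forall>\<^sub>F n in sequentially.
       max_tight_path n r (1 + max_walk_free t (with_proj (PSG r))) \<ge> r - 1 + t)"
proof -
  define A where "A = max_walk_free t (with_proj (PSG r))"
  have le: "1 + A \<le> fact r"
    using max_walk_free_PSG_less_fact[OF assms(2,1)] by (simp add: A_def)
  have upper: "\<forall>\<^sub>F n in sequentially. max_tight_path n r (1 + A) \<ge> r - 1 + t"
    using eventually_max_tight_path_ge[OF assms, of "1 + A"] le by (simp add: A_def)
  have lower: "max_tight_path n r k < r - 1 + t" if "k \<le> A" for n k
    using max_tight_path_less[OF assms] that by (simp add: A_def)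
  have "path_threshold r t = 1 + A"
    unfolding path_threshold_def
  proof (rule Least_equality)
    show "1 + A \<le> fact r \<and> (\<forall>\<^sub>F n in sequentially. max_tight_path n r (1 + A) \<ge> r - 1 + t)"
      using le upper by blast
    fix k assume "k \<le> fact r \<and> (\<forall>\<^sub>F n in sequentially. max_tight_path n r k \<ge> r - 1 + t)"
    \<comment> \<open>A single \<open>n\<close> suffices, since \<open>lower\<close> excludes every
      \<open>k\<close> up to \<open>A\<close> at every \<open>n\<close>.\<close>
    then obtain n where "max_tight_path n r k \<ge> r - 1 + t"
      by (auto simp: eventually_sequentially)
    then show "1 + A \<le> k" using lower[of k n] by linarith
  qed
  then show ?thesis using upper lower by (simp add: A_def)
qed

end
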